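(* Let $p\geq 5$ be prime, and let $r$ be an integer with $1\leq r\leq p-1$ such that $4\bar{3}r+1$ is a quadratic nonresidue modulo $p$, where $\bar{3}$ denotes an inverse of $3$ modulo $p$. Then for all integers $n\geq 0$, $\overline{R_6^\ast}(3(pn+r)+2)\equiv 0 \pmod{8}$.
   Context: An overpartition of $n$ is a partition of $n$ in which the first occurrence of each part size may optionally be overlined. For a positive integer $\ell$, $\overline{R_\ell^\ast}(n)$ denotes the number of overpartitions of $n$ in which no non-overlined part is divisible by $\ell$. Equivalently, with $f_k:=\prod_{i\geq 1}(1-q^{ki})$, one has $\sum_{n\geq 0}\overline{R_\ell^\ast}(n)q^n = \frac{f_2 f_\ell}{f_1^2}$. *)

theory Defs
  imports "HOL-Library.Multiset" "HOL-Number_Theory.Number_Theory"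
begin

text \<open>
  An overpartition is encoded as a pair \<open>(M, S)\<close>: \<open>M\<close> is the multiset of all parts (a
  partition), and \<open>S\<close> is the set of those part sizes whose first occurrence is overlined.
\<close>

definition overpartitions :: "nat \<Rightarrow> (nat multiset \<times> nat set) set" where
  "overpartitions n = {(M, S). 0 \<notin># M \<and> sum_mset M = n \<and> S \<subseteq> set_mset M}"

text \<open>Removing one copy of each overlined size leaves the multiset of non-overlined parts.\<close>

definition nonoverlined :: "nat multiset \<times> nat set \<Rightarrow> nat multiset" where
  "nonoverlined = (\<lambda>(M, S). M - mset_set S)"

definition Rstar :: "nat \<Rightarrow> nat \<Rightarrow> nat" where
  "Rstar l n = card {\<pi> \<in> overpartitions n. \<forall>k \<in># nonoverlined \<pi>. \<not> l dvd k}"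

lemma finite_overpartitions: "finite (overpartitions n)"
proof -
  have size_le: "size M \<le> sum_mset M" if "0 \<notin># M" for M :: "nat multiset"
    using that by (induction M) auto
  have "M \<in> mset ` {xs. set xs \<subseteq> {..n} \<and> length xs \<le> n}"
    if "0 \<notin># M" "sum_mset M = n" for M
  proof -
    obtain xs where xs: "mset xs = M" using ex_mset by blast
    have "set xs \<subseteq> {..n}"
      using that xs by (auto simp: sum_mset_sum_list intro: member_le_sum_list)
    moreover have "length xs \<le> n" using size_le[OF that(1)] that(2) xs by auto
    ultimately show ?thesis using xs by blast
  qed
  then have "overpartitions n \<subseteq>
      (mset ` {xs. set xs \<subseteq> {..n} \<and> length xs \<le> n}) \<times> Pow {..n}"
    by (fastforce simp: overpartitions_def)
  then show ?thesis
    by (rule finite_subset) (simp add: finite_lists_length_le)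
qed

end

theory Submission
  imports Defs "HOL-Computational_Algebra.Formal_Power_Series" "HOL-Library.Z2"
    "HOL-Computational_Algebra.Nth_Powers"
begin

text \<open>
  Write $f_k = \prod_{i \ge 1} (1 - q^{ki})$ and $\varphi = \sum_{j} (-1)^j q^{j^2}$. By Gauss's
  identity $f_1^2 = \varphi f_2$, the generating function $G$ of $\overline{R_6^\ast}$ satisfies
  $G \varphi = f_6$. Splitting $\varphi = U - 2V$ by the residue of the exponent modulo 3 gives
  $G (U^3 - 8 V^3) = f_6 (U^2 + 2UV + 4V^2)$. Here $U$ and $f_6$ are series in $q^3$, $U$ is odd
  only in its constant term, and $V$ has exponents congruent to 1, so the part of $G$ with exponents
  congruent to 2 modulo 3 is 4 times a series congruent to $f_6 V^2$ modulo 2. Two more instances of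
  the Jacobi triple product give, modulo 2, $V f_3 = q f_9^3$ and
  $f_{18}^3 = \sum_j q^{36 j^2 - 18 j}$, so $f_6 V^2 = q^2 f_{18}^3$. Hence
  $\overline{R_6^\ast}(3m+2)$ is divisible by 8 unless $m = 3 \cdot 2j(2j-1)$ for some $j$, in
  which case $4m/3 + 1 = (4j-1)^2$ is a square.
\<close>


unbundle fps_syntax

section \<open>Formal Euler products\<close>

definition trunc_eq :: "nat \<Rightarrow> 'a::comm_ring_1 fps \<Rightarrow> 'a fps \<Rightarrow> bool" where
  "trunc_eq N f g \<longleftrightarrow> (\<forall>i\<le>N. f $ i = g $ i)"

lemma trunc_eq_refl [simp]: "trunc_eq N f f"
  by (simp add: trunc_eq_def)

lemma trunc_eq_sym: "trunc_eq N f g \<Longrightarrow> trunc_eq N g f"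
  by (simp add: trunc_eq_def)

lemma trunc_eq_trans [trans]: "trunc_eq N f g \<Longrightarrow> trunc_eq N g h \<Longrightarrow> trunc_eq N f h"
  by (simp add: trunc_eq_def)

lemma trunc_eq_mult: "trunc_eq N f g \<Longrightarrow> trunc_eq N f' g' \<Longrightarrow> trunc_eq N (f * f') (g * g')"
  by (auto simp: trunc_eq_def fps_mult_nth intro!: sum.cong)

lemma trunc_eqI: "(\<And>N. trunc_eq N f g) \<Longrightarrow> f = g"
  by (auto simp: trunc_eq_def fps_eq_iff)

lemma trunc_eqD: "trunc_eq N f g \<Longrightarrow> f $ N = g $ N"
  by (simp add: trunc_eq_def)

lemma fps_unit_of_nth_0:
  fixes f :: "'a::comm_ring_1 fps"
  assumes "f $ 0 = 1"
  obtains g where "f * g = 1"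
  using fps_right_inverse[of f 1] assms by auto

lemma trunc_eq_cancel:
  assumes "trunc_eq N (f * h) (g * h)" "h $ 0 = 1"
  shows "trunc_eq N f g"
proof -
  obtain k where k: "h * k = 1" using fps_unit_of_nth_0[OF assms(2)] .
  have "trunc_eq N (f * h * k) (g * h * k)"
    by (rule trunc_eq_mult[OF assms(1)]) simp
  then show ?thesis by (simp add: mult.assoc k)
qed

lemma trunc_eq_prod_superset:
  fixes N :: nat
  assumes "finite B" "C \<subseteq> B" "\<And>i. i \<in> B - C \<Longrightarrow> N < i"
  shows "trunc_eq N (\<Prod>i\<in>B. 1 - fps_X ^ i) ((\<Prod>i\<in>C. 1 - fps_X ^ i) :: 'a::comm_ring_1 fps)"
proof -
  have "trunc_eq N (\<Prod>i\<in>D. 1 - fps_X ^ i) (1 :: 'a fps)" if "finite D" "\<And>i. i \<in> D \<Longrightarrow> N < i" for D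
    using that
  proof (induction D)
    case (insert d D)
    have "trunc_eq N (1 - fps_X ^ d) (1 :: 'a fps)"
      using insert.prems[of d] by (auto simp: trunc_eq_def)
    from trunc_eq_mult[OF this insert.IH] show ?case using insert by simp
  qed simp
  from this[of "B - C"] have "trunc_eq N (\<Prod>i\<in>B - C. 1 - fps_X ^ i) (1 :: 'a fps)"
    using assms by blast
  from trunc_eq_mult[OF this trunc_eq_refl, of "\<Prod>i\<in>C. 1 - fps_X ^ i"] show ?thesis
    by (simp add: prod.subset_diff[OF assms(2,1)])
qed

definition euler_prod :: "nat set \<Rightarrow> 'a::comm_ring_1 fps" where
  "euler_prod A = Abs_fps (\<lambda>n. (\<Prod>i\<in>A \<inter> {1..n}. 1 - fps_X ^ i) $ n)"

lemma euler_prod_trunc: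
  assumes "finite B" "B \<subseteq> A" "0 \<notin> B" "A \<inter> {1..N} \<subseteq> B"
  shows "trunc_eq N (euler_prod A) ((\<Prod>i\<in>B. 1 - fps_X ^ i) :: 'a::comm_ring_1 fps)"
  unfolding trunc_eq_def
proof (intro allI impI)
  fix n assume "n \<le> N"
  have "trunc_eq n (\<Prod>i\<in>B. 1 - fps_X ^ i) ((\<Prod>i\<in>A \<inter> {1..n}. 1 - fps_X ^ i) :: 'a fps)"
  proof (rule trunc_eq_prod_superset[OF assms(1)])
    show "A \<inter> {1..n} \<subseteq> B" using assms \<open>n \<le> N\<close> by auto
    fix i assume i: "i \<in> B - A \<inter> {1..n}"
    with assms(2,3) have "i \<noteq> 0" "i \<in> A" by (auto intro!: gr0I)
    with i show "n < i" by auto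
  qed
  then show "euler_prod A $ n = ((\<Prod>i\<in>B. 1 - fps_X ^ i) :: 'a fps) $ n"
    by (simp add: euler_prod_def trunc_eq_def)
qed

lemma euler_prod_trunc_Icc:
  "trunc_eq N (euler_prod A) ((\<Prod>i\<in>A \<inter> {1..N}. 1 - fps_X ^ i) :: 'a::comm_ring_1 fps)"
  by (rule euler_prod_trunc) auto

lemma euler_prod_nth_0 [simp]: "euler_prod A $ 0 = 1"
  by (simp add: euler_prod_def)

lemma euler_prod_Un:
  assumes "A \<inter> B = {}"
  shows "euler_prod (A \<union> B) = (euler_prod A * euler_prod B :: 'a::comm_ring_1 fps)"
proof (rule trunc_eqI)
  fix N
  have "(\<Prod>i\<in>(A \<union> B) \<inter> {1..N}. 1 - fps_X ^ i) =
      ((\<Prod>i\<in>A \<inter> {1..N}. 1 - fps_X ^ i) * (\<Prod>i\<in>B \<inter> {1..N}. 1 - fps_X ^ i) :: 'a fps)"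
    using assms by (subst prod.union_disjoint[symmetric]) (auto simp: Int_Un_distrib2)
  then show "trunc_eq N (euler_prod (A \<union> B)) (euler_prod A * euler_prod B :: 'a fps)"
    using euler_prod_trunc_Icc[of N "A \<union> B"]
      trunc_eq_sym[OF trunc_eq_mult[OF euler_prod_trunc_Icc[of N A] euler_prod_trunc_Icc[of N B]]]
    by (auto intro: trunc_eq_trans)
qed

lemma fps_X_power_shift: "fps_shift c (fps_X ^ c * f) = (f :: 'a::comm_ring_1 fps)"
  by (simp add: fps_eq_iff fps_X_power_mult_nth)

section \<open>Gaussian binomials and the Jacobi triple product\<close>

fun qbinom :: "'a::comm_ring_1 \<Rightarrow> nat \<Rightarrow> nat \<Rightarrow> 'a" where
  "qbinom Q n 0 = 1"
| "qbinom Q 0 (Suc k) = 0"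
| "qbinom Q (Suc n) (Suc k) = Q ^ Suc k * qbinom Q n (Suc k) + qbinom Q n k"

lemma qbinom_gt: "n < k \<Longrightarrow> qbinom Q n k = 0"
  by (induction Q n k rule: qbinom.induct) auto

lemma qbinom_same: "qbinom Q n n = 1"
  by (induction n) (auto simp: qbinom_gt)

lemma prod_power_eq_sum_qbinom:
  "(\<Prod>i<n. y + x * Q ^ i) = (\<Sum>k\<le>n. Q ^ (k choose 2) * qbinom Q n k * x ^ k * y ^ (n - k))"
proof (induction n arbitrary: x)
  case (Suc n)
  have ch: "Suc k choose 2 = (k choose 2) + k" for k
    by (simp add: numeral_2_eq_2)
  let ?f = "\<lambda>k. Q ^ (k choose 2) * qbinom Q n k * (x * Q) ^ k * y ^ (n - k)"
  have top: "?f (Suc n) = 0" by (simp add: qbinom_gt)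
  have "(\<Prod>i<Suc n. y + x * Q ^ i) = (y + x) * (\<Prod>i<n. y + x * Q * Q ^ i)"
    by (subst prod.lessThan_Suc_shift) (simp add: mult.assoc)
  also have "\<dots> = (\<Sum>k\<le>n. y * ?f k) + (\<Sum>k\<le>n. x * ?f k)"
    unfolding Suc.IH by (subst distrib_right) (simp only: sum_distrib_left)
  also have "(\<Sum>k\<le>n. y * ?f k) = y ^ Suc n + (\<Sum>k\<le>n. y * ?f (Suc k))"
  proof -
    have "(\<Sum>k\<le>n. y * ?f k) = (\<Sum>k\<le>Suc n. y * ?f k)" using top by simp
    also have "\<dots> = y * ?f 0 + (\<Sum>k\<le>n. y * ?f (Suc k))" by (rule sum.atMost_Suc_shift)
    finally show ?thesis by (simp add: binomial_eq_0)
  qed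
  also have "y ^ Suc n + (\<Sum>k\<le>n. y * ?f (Suc k)) + (\<Sum>k\<le>n. x * ?f k) =
      y ^ Suc n + (\<Sum>k\<le>n. y * ?f (Suc k) + x * ?f k)"
    by (simp add: sum.distrib)
  also have "(\<Sum>k\<le>n. y * ?f (Suc k) + x * ?f k) =
     (\<Sum>k\<le>n. Q ^ (Suc k choose 2) * qbinom Q (Suc n) (Suc k) * x ^ Suc k * y ^ (Suc n - Suc k))"
  proof (rule sum.cong[OF refl])
    fix k assume "k \<in> {..n}"
    show "y * ?f (Suc k) + x * ?f k =
      Q ^ (Suc k choose 2) * qbinom Q (Suc n) (Suc k) * x ^ Suc k * y ^ (Suc n - Suc k)"
    proof (cases "k = n")
      case True
      then show ?thesis using top
        by (simp add: ch qbinom_gt power_add power_mult_distrib algebra_simps)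
    next
      case False
      with \<open>k \<in> {..n}\<close> have "n - k = Suc (n - Suc k)" by auto
      then show ?thesis
        by (simp add: ch power_add power_mult_distrib algebra_simps)
    qed
  qed
  also have "y ^ Suc n + \<dots> =
      (\<Sum>k\<le>Suc n. Q ^ (k choose 2) * qbinom Q (Suc n) k * x ^ k * y ^ (Suc n - k))"
    by (subst sum.atMost_Suc_shift) (simp add: binomial_eq_0)
  finally show ?case .
qed (simp add: binomial_eq_0)

lemma qbinom_mult_prod:
  "qbinom Q (a + b) a * (\<Prod>i=1..a. 1 - Q ^ i) * (\<Prod>i=1..b. 1 - Q ^ i) = (\<Prod>i=1..a+b. 1 - Q ^ i)"
proof (induction a arbitrary: b)
  case (Suc a)
  note IHa = Suc.IH
  show ?case
  proof (induction b)
    case (Suc b)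
    let ?P = "\<lambda>n. \<Prod>i=1..n. 1 - Q ^ i"
    have P: "?P (Suc n) = (1 - Q ^ Suc n) * ?P n" for n by (simp add: mult.commute)
    have 1: "qbinom Q (Suc (a + b)) (Suc a) * ?P (Suc a) * ?P b = ?P (Suc (a + b))"
      using Suc.IH by simp
    have 2: "qbinom Q (Suc (a + b)) a * ?P a * ?P (Suc b) = ?P (Suc (a + b))"
      using IHa[of "Suc b"] by simp
    have "qbinom Q (Suc a + Suc b) (Suc a) * ?P (Suc a) * ?P (Suc b) =
        Q ^ Suc a * (1 - Q ^ Suc b) * (qbinom Q (Suc (a + b)) (Suc a) * ?P (Suc a) * ?P b)
        + (1 - Q ^ Suc a) * (qbinom Q (Suc (a + b)) a * ?P a * ?P (Suc b))"
      unfolding P[of a] P[of b] add_Suc add_Suc_right qbinom.simps by (simp only: algebra_simps)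
    also have "\<dots> = (1 - Q ^ Suc (Suc (a + b))) * ?P (Suc (a + b))"
      unfolding 1 2 by (simp add: algebra_simps power_add)
    also have "\<dots> = ?P (Suc a + Suc b)" unfolding P[symmetric] by simp
    finally show ?case .
  qed (simp add: qbinom_same)
qed simp

definition theta_exp :: "nat \<Rightarrow> nat \<Rightarrow> int \<Rightarrow> nat" where
  "theta_exp m a j = nat (int m * (j * (j - 1) div 2) + int a * j)"

definition theta :: "nat \<Rightarrow> nat \<Rightarrow> 'a::comm_ring_1 fps" where
  "theta m a = Abs_fps (\<lambda>n. \<Sum>j\<in>{j. theta_exp m a j = n}. (-1) ^ nat \<bar>j\<bar>)"

lemma int_even_consecutive: "2 * (j * (j - 1) div 2) = j * (j - 1)" for j :: int
  by simp

lemma int_theta_exp: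
  assumes "a < m"
  shows "int (theta_exp m a j) = int m * (j * (j - 1) div 2) + int a * j"
    and "0 < a \<Longrightarrow> \<bar>j\<bar> \<le> int (theta_exp m a j)"
proof -
  define T where "T = j * (j - 1) div 2"
  have T2: "2 * T = j * (j - 1)" unfolding T_def by (rule int_even_consecutive)
  have *: "0 \<le> int m * T + int a * j \<and> (0 < a \<longrightarrow> \<bar>j\<bar> \<le> int m * T + int a * j)"
  proof (cases "j \<ge> 1")
    case True
    then have "0 \<le> 2 * T" unfolding T2 by simp
    then have "0 \<le> int m * T" by simp
    moreover have "j \<le> int a * j" if "0 < a" using that True by simp
    moreover have "0 \<le> int a * j" using True by simp
    ultimately show ?thesis using True by linarith
  next
    case False
    then have "0 \<le> (- j) * (- 1 - j)" if "j \<noteq> 0" using that by (intro mult_nonneg_nonneg) auto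
    then have "- 2 * j \<le> 2 * T" unfolding T2 by (cases "j = 0") (auto simp: algebra_simps)
    then have "int m * (- j) \<le> int m * T" by (intro mult_left_mono) auto
    moreover have "1 * (- j) \<le> (int m - int a) * (- j)"
      using False assms by (intro mult_right_mono) auto
    ultimately show ?thesis using False by (auto simp: algebra_simps)
  qed
  then show "int (theta_exp m a j) = int m * (j * (j - 1) div 2) + int a * j"
    by (simp add: theta_exp_def T_def)
  then show "0 < a \<Longrightarrow> \<bar>j\<bar> \<le> int (theta_exp m a j)" using * by (simp add: T_def)
qed

lemma int_theta_exp_double:
  assumes "a < m"
  shows "2 * int (theta_exp m a j) = int m * (j * (j - 1)) + 2 * int a * j"
proof -
  have "2 * int (theta_exp m a j) = int m * (2 * (j * (j - 1) div 2)) + 2 * int a * j"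
    unfolding int_theta_exp(1)[OF assms] by (simp only: distrib_left mult_ac)
  then show ?thesis by (simp only: int_even_consecutive)
qed

lemma finite_jacobi_triple:
  assumes "0 < a" "a < m"
  shows "(\<Prod>i<n. 1 - fps_X ^ (m * Suc i - a)) * (\<Prod>i<n. 1 - fps_X ^ (m * i + a)) =
    (\<Sum>k\<le>2*n. (-1) ^ (n + k) * fps_X ^ theta_exp m a (int k - int n) *
        qbinom (fps_X ^ m) (2 * n) k :: 'a::comm_ring_1 fps)"
proof (cases "n = 0")
  case False
  let ?X = "fps_X :: 'a fps"
  define c where "c = m * (n choose 2) + (m * n - a) * n"
  have le: "a \<le> m * n" using assms False by (cases n) auto
  have gauss: "int (k choose 2) = int k * (int k - 1) div 2" for k
    by (cases k) (auto simp: choose_two zdiv_int algebra_simps)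
  have choose: "2 * int (k choose 2) = int k * (int k - 1)" for k
    unfolding gauss by (rule int_even_consecutive)
  have expo: "m * (k choose 2) + (m * n - a) * (2 * n - k) = c + theta_exp m a (int k - int n)"
    if "k \<le> 2 * n" for k
  proof -
    have "2 * int (theta_exp m a (int k - int n)) =
       int m * ((int k - int n) * (int k - int n - 1)) + 2 * int a * (int k - int n)"
      by (rule int_theta_exp_double[OF assms(2)])
    moreover have "2 * int (m * (k choose 2) + (m * n - a) * (2 * n - k)) =
       int m * (int k * (int k - 1)) + 2 * (int m * int n - int a) * (2 * int n - int k)"
    proof -
      have "int (m * n - a) = int m * int n - int a" "int (2 * n - k) = 2 * int n - int k"
        using le that by (simp_all add: of_nat_diff)
      note d = this
      show ?thesis
        unfolding of_nat_add of_nat_mult d choose[symmetric] by (simp add: algebra_simps)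
    qed
    moreover have "2 * int c = int m * (int n * (int n - 1)) + 2 * (int m * int n - int a) * int n"
    proof -
      have "int (m * n - a) = int m * int n - int a" using le by (simp add: of_nat_diff)
      note d = this
      show ?thesis
        unfolding c_def of_nat_add of_nat_mult d choose[symmetric] by (simp add: algebra_simps)
    qed
    ultimately have "2 * int (m * (k choose 2) + (m * n - a) * (2 * n - k)) =
        2 * int (c + theta_exp m a (int k - int n))"
      by (simp add: algebra_simps)
    then show ?thesis by (simp only: mult_cancel_left of_nat_eq_iff) simp
  qed
  have "(\<Prod>i<2*n. ?X ^ (m * n - a) + (- 1) * (?X ^ m) ^ i) =
      (\<Prod>i<n. ?X ^ (m * n - a) + (- 1) * (?X ^ m) ^ i) *
      (\<Prod>i<n. ?X ^ (m * n - a) + (- 1) * (?X ^ m) ^ (i + n))"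
  proof -
    have "prod g {..<n + k} = prod g {..<n} * (\<Prod>i<k. g (i + n))" for g :: "nat \<Rightarrow> 'a fps" and k
      by (induction k) (simp_all add: ac_simps)
    then show ?thesis by (simp only: mult_2)
  qed
  also have "(\<Prod>i<n. ?X ^ (m * n - a) + (- 1) * (?X ^ m) ^ i) =
     (-1) ^ n * ?X ^ (m * (n choose 2)) * (\<Prod>i<n. 1 - ?X ^ (m * Suc i - a))"
  proof -
    have "?X ^ (m * n - a) + (- 1) * (?X ^ m) ^ i =
        (- 1) * (?X ^ m) ^ i * (1 - ?X ^ (m * Suc (n - Suc i) - a))" if "i < n" for i
    proof -
      have "m * 1 \<le> m * (n - i)" using that by (intro mult_le_mono) auto
      then have "a \<le> m * (n - i)" using assms by linarith
      moreover have "m * n = m * i + m * (n - i)" using that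
        by (metis add_diff_inverse_nat distrib_left less_imp_not_less)
      ultimately have "m * n - a = m * i + (m * (n - i) - a)" by simp
      moreover have "Suc (n - Suc i) = n - i" using that by simp
      ultimately show ?thesis
        by (simp add: algebra_simps flip: power_mult power_add)
    qed
    then have "(\<Prod>i<n. ?X ^ (m * n - a) + (- 1) * (?X ^ m) ^ i) =
        (\<Prod>i<n. (- 1) * (?X ^ m) ^ i * (1 - ?X ^ (m * Suc (n - Suc i) - a)))"
      by (intro prod.cong) auto
    also have "\<dots> = (\<Prod>i<n. - 1) * (\<Prod>i<n. (?X ^ m) ^ i) *
        (\<Prod>i<n. 1 - ?X ^ (m * Suc (n - Suc i) - a))"
      by (simp only: prod.distrib)
    also have "(\<Prod>i<n. 1 - ?X ^ (m * Suc (n - Suc i) - a)) =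
        (\<Prod>i<n. 1 - ?X ^ (m * Suc i - a))"
      by (rule prod.nat_diff_reindex)
    also have "(\<Prod>i<n. (?X ^ m) ^ i) = ?X ^ (m * (n choose 2))"
    proof -
      have "(\<Sum>i<n. i) = n choose 2"
        by (induction n) (auto simp: numeral_2_eq_2)
      then show ?thesis
        by (simp add: power_mult flip: power_sum)
    qed
    finally show ?thesis by simp
  qed
  also have "(\<Prod>i<n. ?X ^ (m * n - a) + (- 1) * (?X ^ m) ^ (i + n)) =
     ?X ^ ((m * n - a) * n) * (\<Prod>i<n. 1 - ?X ^ (m * i + a))"
  proof -
    have "?X ^ (m * n - a) + (- 1) * (?X ^ m) ^ (i + n) =
        ?X ^ (m * n - a) * (1 - ?X ^ (m * i + a))" for i
    proof -
      have "m * (i + n) = (m * n - a) + (m * i + a)" using le by (simp add: algebra_simps)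
      then show ?thesis
        by (simp add: algebra_simps flip: power_mult power_add)
    qed
    then show ?thesis by (simp add: prod.distrib power_mult)
  qed
  finally have "?X ^ c * ((\<Prod>i<n. 1 - ?X ^ (m * Suc i - a)) * (\<Prod>i<n. 1 - ?X ^ (m * i + a))) =
     (-1) ^ n * (\<Prod>i<2*n. ?X ^ (m * n - a) + (- 1) * (?X ^ m) ^ i)"
    by (simp add: c_def power_add mult_ac flip: power_mult_distrib)
  also have "\<dots> = (\<Sum>k\<le>2*n. (-1) ^ n * ((?X ^ m) ^ (k choose 2) * qbinom (?X ^ m) (2 * n) k *
      (- 1) ^ k * (?X ^ (m * n - a)) ^ (2 * n - k)))"
    by (simp only: prod_power_eq_sum_qbinom sum_distrib_left)
  also have "\<dots> = (\<Sum>k\<le>2*n. ?X ^ c * ((-1) ^ (n + k) * ?X ^ theta_exp m a (int k - int n) *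
        qbinom (?X ^ m) (2 * n) k))"
  proof (rule sum.cong[OF refl])
    fix k assume "k \<in> {..2*n}"
    then have XX: "(?X ^ m) ^ (k choose 2) * (?X ^ (m * n - a)) ^ (2 * n - k) =
        ?X ^ c * ?X ^ theta_exp m a (int k - int n)"
      by (simp add: expo flip: power_mult power_add)
    have "(-1) ^ n * ((?X ^ m) ^ (k choose 2) * qbinom (?X ^ m) (2 * n) k *
      (- 1) ^ k * (?X ^ (m * n - a)) ^ (2 * n - k)) =
      (-1) ^ n * (- 1) ^ k * qbinom (?X ^ m) (2 * n) k *
        ((?X ^ m) ^ (k choose 2) * (?X ^ (m * n - a)) ^ (2 * n - k))"
      by (simp only: mult_ac)
    then show "(-1) ^ n * ((?X ^ m) ^ (k choose 2) * qbinom (?X ^ m) (2 * n) k *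
      (- 1) ^ k * (?X ^ (m * n - a)) ^ (2 * n - k)) = ?X ^ c * ((-1) ^ (n + k) *
        ?X ^ theta_exp m a (int k - int n) * qbinom (?X ^ m) (2 * n) k)"
      unfolding XX by (simp only: power_add mult_ac)
  qed
  also have "\<dots> = ?X ^ c * (\<Sum>k\<le>2*n. (-1) ^ (n + k) * ?X ^ theta_exp m a (int k - int n) *
        qbinom (?X ^ m) (2 * n) k)"
    by (simp only: sum_distrib_left)
  finally have "fps_shift c (?X ^ c * ((\<Prod>i<n. 1 - ?X ^ (m * Suc i - a)) * (\<Prod>i<n. 1 - ?X ^ (m * i + a)))) =
      fps_shift c (?X ^ c * (\<Sum>k\<le>2*n. (-1) ^ (n + k) * ?X ^ theta_exp m a (int k - int n) *
        qbinom (?X ^ m) (2 * n) k))"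
    by (rule arg_cong)
  then show ?thesis by (simp only: fps_X_power_shift)
qed (use assms in \<open>simp add: theta_exp_def\<close>)

lemma euler_prod_trunc_image:
  assumes "finite F" "inj_on f F" "f ` F \<subseteq> A" "0 \<notin> f ` F" "A \<inter> {1..N} \<subseteq> f ` F"
  shows "trunc_eq N (euler_prod A) ((\<Prod>i\<in>F. 1 - fps_X ^ f i) :: 'a::comm_ring_1 fps)"
  using euler_prod_trunc[OF finite_imageI[OF assms(1)] assms(3-5), where ?'a = 'a]
  by (simp add: prod.reindex[OF assms(2)])

definition euler_fun :: "nat \<Rightarrow> 'a::comm_ring_1 fps" where
  "euler_fun k = euler_prod {i. 0 < i \<and> k dvd i}"

lemma euler_fun_nth_0 [simp]: "euler_fun k $ 0 = 1"
  by (simp add: euler_fun_def)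

lemma euler_fun_trunc:
  assumes "0 < k" "N \<le> n"
  shows "trunc_eq N (euler_fun k) ((\<Prod>i=1..n. 1 - fps_X ^ (k * i)) :: 'a::comm_ring_1 fps)"
  unfolding euler_fun_def
proof (rule euler_prod_trunc_image)
  show "{i. 0 < i \<and> k dvd i} \<inter> {1..N} \<subseteq> (*) k ` {1..n}"
  proof
    fix x assume "x \<in> {i. 0 < i \<and> k dvd i} \<inter> {1..N}"
    then obtain i where i: "x = k * i" "0 < i" "k * i \<le> N" by auto
    have "1 * i \<le> k * i" using assms by (intro mult_le_mono) auto
    with i assms have "i \<le> n" by linarith
    with i have "i \<in> {1..n}" by simp
    with i show "x \<in> (*) k ` {1..n}" by blast
  qed
qed (use assms in \<open>auto simp: inj_on_def\<close>)

lemma euler_prod_residue_trunc: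
  assumes "0 < b" "b < m" "N < n"
  shows "trunc_eq N (euler_prod {i. i mod m = b})
    ((\<Prod>i<n. 1 - fps_X ^ (m * i + b)) :: 'a::comm_ring_1 fps)"
proof (rule euler_prod_trunc_image)
  show "{i. i mod m = b} \<inter> {1..N} \<subseteq> (\<lambda>i. m * i + b) ` {..<n}"
  proof
    fix x assume x: "x \<in> {i. i mod m = b} \<inter> {1..N}"
    then have "x = m * (x div m) + b" by (metis (mono_tags) IntD1 mem_Collect_eq mult_div_mod_eq)
    moreover have "x div m < n"
      using x assms by (auto intro!: le_less_trans[OF div_le_dividend])
    ultimately show "x \<in> (\<lambda>i. m * i + b) ` {..<n}" by blast
  qed
qed (use assms in \<open>auto simp: inj_on_def\<close>)

theorem jacobi_triple_product:
  assumes "0 < a" "a < m"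
  shows "euler_prod {i. i mod m = m - a} * euler_prod {i. i mod m = a} * euler_fun m =
    (theta m a :: 'a::comm_ring_1 fps)"
proof (rule fps_ext)
  fix N :: nat
  define n where "n = 2 * N + 1"
  let ?E = "euler_fun m :: 'a fps"
  let ?L = "(\<Prod>i<n. 1 - fps_X ^ (m * Suc i - a)) * (\<Prod>i<n. 1 - fps_X ^ (m * i + a)) :: 'a fps"
  have "trunc_eq N (euler_prod {i. i mod m = m - a})
      ((\<Prod>i<n. 1 - fps_X ^ (m * i + (m - a))) :: 'a fps)"
    by (rule euler_prod_residue_trunc) (use assms in \<open>auto simp: n_def\<close>)
  then have 1: "trunc_eq N (euler_prod {i. i mod m = m - a})
      ((\<Prod>i<n. 1 - fps_X ^ (m * Suc i - a)) :: 'a fps)"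
    using assms by (simp add: add.commute)
  have 2: "trunc_eq N (euler_prod {i. i mod m = a}) ((\<Prod>i<n. 1 - fps_X ^ (m * i + a)) :: 'a fps)"
    by (rule euler_prod_residue_trunc) (use assms in \<open>auto simp: n_def\<close>)
  have qb: "trunc_eq N (qbinom (fps_X ^ m) (2 * n) k * ?E) 1"
    if k: "N \<le> k" "N \<le> 2 * n - k" "k \<le> 2 * n" for k
  proof -
    let ?q = "qbinom (fps_X ^ m) (2 * n) k :: 'a fps"
    let ?P = "\<lambda>n. (\<Prod>i=1..n. 1 - (fps_X ^ m) ^ i) :: 'a fps"
    have P: "trunc_eq N ?E (?P l)" if "N \<le> l" for l
      using euler_fun_trunc[of m N l, where ?'a = 'a] assms that by (simp add: power_mult)
    have "trunc_eq N (?q * ?E * ?E) (?q * ?P k * ?P (2 * n - k))"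
      by (intro trunc_eq_mult P k) simp
    also have "?q * ?P k * ?P (2 * n - k) = ?P (2 * n)"
      using qbinom_mult_prod[of "fps_X ^ m :: 'a fps" k "2 * n - k"] k by simp
    also have "trunc_eq N (?P (2 * n)) (1 * ?E)"
      using P[of "2 * n"] by (simp add: n_def trunc_eq_sym)
    finally show ?thesis by (rule trunc_eq_cancel) simp
  qed
  have coeff: "((-1) ^ (n + k) * fps_X ^ theta_exp m a (int k - int n) * qbinom (fps_X ^ m) (2 * n) k * ?E) $ N
      = (if theta_exp m a (int k - int n) = N then (-1) ^ (n + k) else 0)"
    if k: "k \<le> 2 * n" for k
  proof -
    let ?e = "theta_exp m a (int k - int n)" and ?q = "qbinom (fps_X ^ m) (2 * n) k :: 'a fps"
    have sgn: "((-1) ^ l * f) $ i = (-1) ^ l * f $ i" for l i and f :: "'a fps"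
      by (cases "even l") auto
    have "(fps_X ^ ?e * (?q * ?E)) $ N = (if ?e = N then 1 else 0)"
    proof (cases "?e \<le> N")
      case True
      then have "\<bar>int k - int n\<bar> \<le> int N"
        using int_theta_exp(2)[OF assms(2,1), of "int k - int n"] by linarith
      then have "trunc_eq N (?q * ?E) 1" using k by (intro qb) (auto simp: n_def)
      then have "(?q * ?E) $ (N - ?e) = (1 :: 'a fps) $ (N - ?e)" by (simp add: trunc_eq_def)
      then show ?thesis using True by (auto simp: fps_X_power_mult_nth)
    qed (auto simp: fps_X_power_mult_nth)
    then show ?thesis by (simp add: sgn mult.assoc)
  qed
  have "trunc_eq N (euler_prod {i. i mod m = m - a} * euler_prod {i. i mod m = a} * ?E) (?L * ?E)"
    by (intro trunc_eq_mult 1 2) simp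
  then have "(euler_prod {i. i mod m = m - a} * euler_prod {i. i mod m = a} * ?E) $ N = (?L * ?E) $ N"
    by (rule trunc_eqD)
  also have "\<dots> = (\<Sum>k\<le>2*n. if theta_exp m a (int k - int n) = N then (-1) ^ (n + k) else 0)"
    unfolding finite_jacobi_triple[OF assms] sum_distrib_right fps_sum_nth
    by (intro sum.cong) (simp_all add: coeff)
  also have "\<dots> = (\<Sum>k\<in>{k. k \<le> 2*n \<and> theta_exp m a (int k - int n) = N}. (-1) ^ (n + k))"
    by (simp add: sum.inter_filter[symmetric])
  also have "\<dots> = (\<Sum>j\<in>{j. theta_exp m a j = N}. (-1) ^ nat \<bar>j\<bar>)"
  proof (rule sum.reindex_bij_witness[where i = "\<lambda>j. nat (j + int n)" and j = "\<lambda>k. int k - int n"])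
    fix j assume "j \<in> {j. theta_exp m a j = N}"
    then have "\<bar>j\<bar> \<le> int n" using int_theta_exp(2)[OF assms(2,1), of j] by (simp add: n_def)
    then show "int (nat (j + int n)) - int n = j"
      "nat (j + int n) \<in> {k. k \<le> 2 * n \<and> theta_exp m a (int k - int n) = N}"
      using \<open>j \<in> _\<close> by auto
  next
    fix k
    have "even (nat \<bar>int k - int n\<bar>) \<longleftrightarrow> even (n + k)" by (auto simp: even_nat_iff)
    then show "(- 1) ^ nat \<bar>int k - int n\<bar> = ((- 1) ^ (n + k) :: 'a)"
      by (simp only: minus_one_power_iff)
  qed auto
  finally show "(euler_prod {i. i mod m = m - a} * euler_prod {i. i mod m = a} * ?E) $ N =
      (theta m a :: 'a fps) $ N"
    by (simp add: theta_def)
qed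

section \<open>Reduction modulo 2\<close>

lemma bit_fps_two [simp]: "(2 :: bit fps) = 0"
  by (simp add: numeral_fps_const)

lemma bit_fps_one_minus_power: "1 - (fps_X :: bit fps) ^ (2 * k) = (1 - fps_X ^ k)\<^sup>2"
proof -
  have "(1 - (fps_X :: bit fps) ^ k)\<^sup>2 = 1 + fps_X ^ (2 * k) - (fps_X ^ k + fps_X ^ k)"
    by (simp add: power2_eq_square algebra_simps mult_2 flip: power_add)
  also have "\<dots> = 1 - fps_X ^ (2 * k)" by (simp add: fps_eq_iff flip: mult_2)
  finally show ?thesis by simp
qed

lemma bit_euler_fun_double:
  assumes "0 < k"
  shows "euler_fun (2 * k) = (euler_fun k :: bit fps)\<^sup>2"
proof (rule trunc_eqI)
  fix N
  let ?P = "\<lambda>k. (\<Prod>i=1..N. 1 - fps_X ^ (k * i)) :: bit fps"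
  have "?P (2 * k) = (?P k)\<^sup>2"
    by (simp only: mult.assoc bit_fps_one_minus_power prod_power_distrib)
  moreover have "trunc_eq N (euler_fun (2 * k)) (?P (2 * k))"
    by (rule euler_fun_trunc) (use assms in auto)
  moreover have "trunc_eq N ((euler_fun k)\<^sup>2) ((?P k)\<^sup>2)"
    unfolding power2_eq_square
    by (intro trunc_eq_mult euler_fun_trunc) (use assms in auto)
  ultimately show "trunc_eq N (euler_fun (2 * k)) ((euler_fun k :: bit fps)\<^sup>2)"
    by (metis trunc_eq_sym trunc_eq_trans)
qed

lemma euler_fun_residues:
  assumes "0 < k" "0 < d"
  shows "euler_fun k = (\<Prod>c\<in>{0<..<d}. euler_prod {i. i mod (k * d) = k * c}) * euler_fun (k * d)"
proof -
  have *: "euler_prod ({i. \<exists>c\<in>C. i mod (k * d) = k * c} \<union> {i. 0 < i \<and> k * d dvd i})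
      = (\<Prod>c\<in>C. euler_prod {i. i mod (k * d) = k * c}) * euler_fun (k * d)"
    if "finite C" "0 \<notin> C" for C
    using that
  proof (induction C)
    case (insert c C)
    have "{i. \<exists>c\<in>insert c C. i mod (k * d) = k * c} \<union> {i. 0 < i \<and> k * d dvd i} =
        {i. i mod (k * d) = k * c} \<union>
        ({i. \<exists>c\<in>C. i mod (k * d) = k * c} \<union> {i. 0 < i \<and> k * d dvd i})"
      by auto
    moreover have "{i. i mod (k * d) = k * c} \<inter>
        ({i. \<exists>c\<in>C. i mod (k * d) = k * c} \<union> {i. 0 < i \<and> k * d dvd i}) = {}"
      using insert assms by auto
    ultimately show ?case
      using insert by (simp only: euler_prod_Un) (simp add: mult.assoc)
  qed (simp add: euler_fun_def)
  have "{i. 0 < i \<and> k dvd i} =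
      {i. \<exists>c\<in>{0<..<d}. i mod (k * d) = k * c} \<union> {i. 0 < i \<and> k * d dvd i}"
  proof (intro equalityI subsetI)
    fix i assume "i \<in> {i. 0 < i \<and> k dvd i}"
    then obtain q where q: "i = k * q" "0 < i" by auto
    have "i mod (k * d) = k * (q mod d)" using q by simp
    moreover have "q mod d < d" using assms by simp
    ultimately show "i \<in> {i. \<exists>c\<in>{0<..<d}. i mod (k * d) = k * c} \<union> {i. 0 < i \<and> k * d dvd i}"
      using q by (cases "q mod d = 0") auto
  next
    fix i assume i: "i \<in> {i. \<exists>c\<in>{0<..<d}. i mod (k * d) = k * c} \<union> {i. 0 < i \<and> k * d dvd i}"
    have "k dvd i mod (k * d) \<Longrightarrow> k dvd i" by (metis dvd_mod_iff dvd_triv_left)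
    with i assms show "i \<in> {i. 0 < i \<and> k dvd i}" by (auto intro!: gr0I dest: dvd_mult_left)
  qed
  then show ?thesis using *[of "{0<..<d}"] by (simp add: euler_fun_def)
qed

lemma bit_theta_eq_euler_fun_cube:
  assumes "0 < k"
  shows "theta (4 * k) k = (euler_fun k :: bit fps) ^ 3"
proof -
  let ?f = "euler_fun :: nat \<Rightarrow> bit fps"
  let ?R = "\<lambda>c. euler_prod {i. i mod (4 * k) = c * k} :: bit fps"
  have nz: "?f j \<noteq> 0" for j by (metis euler_fun_nth_0 fps_zero_nth zero_neq_one)
  have "{0<..<4} = {1, 2, 3 :: nat}" "{0<..<2} = {1 :: nat}" by auto
  then have f1: "?f k = ?R 1 * ?R 2 * ?R 3 * ?f (4 * k)" and f2: "?f (2 * k) = ?R 2 * ?f (4 * k)"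
    using euler_fun_residues[of k 4, where ?'a = bit] euler_fun_residues[of "2 * k" 2, where ?'a = bit] assms
    by (simp_all add: mult_ac)
  have "theta (4 * k) k = ?R 3 * ?R 1 * ?f (4 * k)"
    using jacobi_triple_product[of k "4 * k", where ?'a = bit] assms by simp
  then have "theta (4 * k) k * ?f (2 * k) = ?f k * ?f (4 * k)"
    unfolding f1 f2 by (simp only: mult_ac)
  moreover have "?f (2 * k) = (?f k)\<^sup>2" "?f (4 * k) = (?f k) ^ 4"
    using bit_euler_fun_double[of k] bit_euler_fun_double[of "2 * k"] assms by simp_all
  ultimately have "theta (4 * k) k * (?f k)\<^sup>2 = ?f k ^ 3 * (?f k)\<^sup>2"
    by (simp flip: power_Suc power_add)
  then show ?thesis by (metis mult_right_cancel nz power_not_zero)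
qed

lemma bit_theta_mult_euler_fun:
  assumes "0 < k"
  shows "theta (6 * k) k * euler_fun k = (euler_fun (3 * k) :: bit fps) ^ 3"
proof -
  let ?f = "euler_fun :: nat \<Rightarrow> bit fps"
  let ?R = "\<lambda>c. euler_prod {i. i mod (6 * k) = c * k} :: bit fps"
  have nz: "?f j \<noteq> 0" for j by (metis euler_fun_nth_0 fps_zero_nth zero_neq_one)
  have "{0<..<6} = {1, 2, 3, 4, 5 :: nat}" "{0<..<3} = {1, 2 :: nat}" "{0<..<2} = {1 :: nat}" by auto
  then have f1: "?f k = ?R 1 * ?R 2 * ?R 3 * ?R 4 * ?R 5 * ?f (6 * k)"
    and f2: "?f (2 * k) = ?R 2 * ?R 4 * ?f (6 * k)"
    and f3: "?f (3 * k) = ?R 3 * ?f (6 * k)"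
    using euler_fun_residues[of k 6, where ?'a = bit] euler_fun_residues[of "2 * k" 3, where ?'a = bit]
      euler_fun_residues[of "3 * k" 2, where ?'a = bit] assms
    by (simp_all add: mult_ac)
  have "theta (6 * k) k = ?R 5 * ?R 1 * ?f (6 * k)"
    using jacobi_triple_product[of k "6 * k", where ?'a = bit] assms by simp
  then have "theta (6 * k) k * (?f (2 * k) * ?f (3 * k)) = ?f k * (?f (6 * k))\<^sup>2"
    unfolding f1 f2 f3 power2_eq_square by (simp only: mult_ac)
  moreover have "?f (2 * k) = (?f k)\<^sup>2" "?f (6 * k) = (?f (3 * k))\<^sup>2"
    using bit_euler_fun_double[of k] bit_euler_fun_double[of "3 * k"] assms by simp_all
  ultimately have "theta (6 * k) k * ?f k * (?f k * ?f (3 * k)) = ?f (3 * k) ^ 3 * (?f k * ?f (3 * k))"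
    by (simp add: power2_eq_square power3_eq_cube mult_ac)
  then show ?thesis using nz by simp
qed

definition fps_mod2 :: "int fps \<Rightarrow> bit fps" where
  "fps_mod2 f = Abs_fps (\<lambda>n. of_int (f $ n))"

lemma fps_mod2_nth [simp]: "fps_mod2 f $ n = of_int (f $ n)"
  by (simp add: fps_mod2_def)

lemma fps_mod2_mult: "fps_mod2 (f * g) = fps_mod2 f * fps_mod2 g"
  by (simp add: fps_eq_iff fps_mult_nth)

lemma fps_mod2_1: "fps_mod2 1 = 1"
  by (simp add: fps_eq_iff)

lemma fps_mod2_power: "fps_mod2 (f ^ n) = fps_mod2 f ^ n"
  by (induction n) (simp_all add: fps_mod2_mult fps_mod2_1)

lemma fps_mod2_euler_prod: "fps_mod2 (euler_prod A) = euler_prod A"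
proof -
  have "fps_mod2 (\<Prod>i\<in>B. 1 - fps_X ^ i) = (\<Prod>i\<in>B. 1 - fps_X ^ i)" if "finite B" for B
    using that
  proof (induction B)
    case (insert b B)
    have "fps_mod2 (1 - fps_X ^ b) = 1 - fps_X ^ b" by (simp add: fps_eq_iff)
    with insert show ?case by (simp add: fps_mod2_mult)
  qed (simp add: fps_eq_iff)
  then have "of_int ((\<Prod>i\<in>B. 1 - fps_X ^ i) $ n) = ((\<Prod>i\<in>B. 1 - fps_X ^ i) :: bit fps) $ n"
    if "finite B" for B n
    using that by (metis fps_mod2_nth)
  then show ?thesis by (simp add: fps_eq_iff euler_prod_def)
qed

section \<open>The generating function of overpartitions\<close>

definition partitions_in :: "nat set \<Rightarrow> nat \<Rightarrow> nat multiset set" where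
  "partitions_in A n = {M. set_mset M \<subseteq> A \<and> sum_mset M = n}"

definition distinct_partitions_in :: "nat set \<Rightarrow> nat \<Rightarrow> nat set set" where
  "distinct_partitions_in A n = {S. finite S \<and> S \<subseteq> A \<and> \<Sum>S = n}"

definition partition_gf :: "nat set \<Rightarrow> int fps" where
  "partition_gf A = Abs_fps (\<lambda>n. int (card (partitions_in A n)))"

definition distinct_partition_gf :: "nat set \<Rightarrow> int fps" where
  "distinct_partition_gf A = Abs_fps (\<lambda>n. int (card (distinct_partitions_in A n)))"

lemma finite_partitions_in:
  assumes "0 \<notin> A"
  shows "finite (partitions_in A n)"
proof (rule finite_surj[OF finite_overpartitions])
  show "partitions_in A n \<subseteq> fst ` overpartitions n"
    using assms by (force simp: partitions_in_def overpartitions_def image_iff)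
qed

lemma le_sum_mset: "x \<in># M \<Longrightarrow> x \<le> sum_mset M" for x :: nat
  by (metis le_add1 multi_member_split sum_mset.add_mset)

lemma partitions_in_Icc:
  assumes "0 \<notin> A" "k \<le> n"
  shows "partitions_in (A \<inter> {1..n}) k = partitions_in A k"
proof -
  have "x \<in> {1..n}" if "x \<in># M" "sum_mset M = k" "set_mset M \<subseteq> A" for x M
    using le_sum_mset[OF that(1)] that assms by (cases x) auto
  then show ?thesis by (auto simp: partitions_in_def)
qed

lemma distinct_partitions_in_Icc:
  assumes "0 \<notin> A" "k \<le> n"
  shows "distinct_partitions_in (A \<inter> {1..n}) k = distinct_partitions_in A k"
proof -
  have "x \<in> {1..n}" if "x \<in> S" "\<Sum>S = k" "finite S" "S \<subseteq> A" for x S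
  proof -
    have "x \<le> \<Sum>S" using that by (intro member_le_sum) auto
    with that assms show ?thesis by (cases x) auto
  qed
  then show ?thesis by (auto simp: distinct_partitions_in_def)
qed

lemma partition_gf_mult_finite:
  assumes "finite B" "0 \<notin> B"
  shows "partition_gf B * (\<Prod>i\<in>B. 1 - fps_X ^ i) = 1"
  using assms
proof (induction B)
  case empty
  have "partitions_in {} n = (if n = 0 then {{#}} else {})" for n
    by (auto simp: partitions_in_def)
  then show ?case by (simp add: partition_gf_def fps_eq_iff)
next
  case (insert b B)
  have b: "0 < b" "0 \<notin> insert b B" using insert.prems by auto
  have "card (partitions_in (insert b B) n) =
      card (partitions_in B n) + (if n < b then 0 else card (partitions_in (insert b B) (n - b)))" for n
  proof -
    let ?I = "if n < b then {} else add_mset b ` partitions_in (insert b B) (n - b)"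
    have split: "partitions_in (insert b B) n = partitions_in B n \<union> ?I"
    proof (intro equalityI subsetI)
      fix M assume M: "M \<in> partitions_in (insert b B) n"
      show "M \<in> partitions_in B n \<union> ?I"
      proof (cases "b \<in># M")
        case True
        then obtain M' where M': "M = add_mset b M'" by (metis multi_member_split)
        with M have "\<not> n < b" "M' \<in> partitions_in (insert b B) (n - b)"
          by (auto simp: partitions_in_def)
        with M' show ?thesis by auto
      qed (use M in \<open>auto simp: partitions_in_def\<close>)
    qed (auto simp: partitions_in_def split: if_splits)
    have "card (partitions_in (insert b B) n) = card (partitions_in B n) + card ?I"
      unfolding split
    proof (rule card_Un_disjoint)
      show "finite (partitions_in B n)" "finite ?I"
        using finite_partitions_in[OF b(2)] finite_partitions_in[of B] b by auto
      show "partitions_in B n \<inter> ?I = {}"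
      proof -
        have "b \<notin># M" if "M \<in> partitions_in B n" for M
          using that insert.hyps unfolding partitions_in_def by blast
        moreover have "b \<in># M" if "M \<in> ?I" for M
          using that by (auto split: if_splits)
        ultimately show ?thesis by blast
      qed
    qed
    also have "card ?I = (if n < b then 0 else card (partitions_in (insert b B) (n - b)))"
      by (simp add: card_image inj_on_def)
    finally show ?thesis .
  qed
  then have "partition_gf (insert b B) = partition_gf B + fps_X ^ b * partition_gf (insert b B)"
    by (simp add: fps_eq_iff partition_gf_def fps_X_power_mult_nth)
  then have "partition_gf (insert b B) * (1 - fps_X ^ b) = partition_gf B"
    by (simp add: algebra_simps)
  then show ?case
    using insert by (simp add: mult.assoc[symmetric])
qed

lemma partition_gf_mult_euler_prod:
  assumes "0 \<notin> A"
  shows "partition_gf A * euler_prod A = 1"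
proof (rule trunc_eqI)
  fix N
  let ?B = "A \<inter> {1..N}"
  have "trunc_eq N (partition_gf A) (partition_gf ?B)"
    using partitions_in_Icc[OF assms] by (simp add: trunc_eq_def partition_gf_def)
  from trunc_eq_mult[OF this euler_prod_trunc_Icc[of N A]]
  show "trunc_eq N (partition_gf A * euler_prod A) 1"
    by (subst (asm) partition_gf_mult_finite) auto
qed

lemma distinct_partition_gf_finite:
  assumes "finite B"
  shows "distinct_partition_gf B = (\<Prod>i\<in>B. 1 + fps_X ^ i)"
proof -
  have "(\<Prod>i\<in>B. 1 + fps_X ^ i :: int fps) = (\<Prod>i\<in>B. fps_X ^ i + 1)" by (simp add: add.commute)
  also have "\<dots> = (\<Sum>S\<in>Pow B. fps_X ^ \<Sum>S)"
    by (simp add: prod_add[OF assms] power_sum)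
  also have "\<dots> = distinct_partition_gf B"
  proof (rule fps_ext)
    fix n
    have "(\<Sum>S\<in>Pow B. fps_X ^ \<Sum>S) $ n = (\<Sum>S\<in>Pow B. if \<Sum>S = n then 1 else 0 :: int)"
      by (auto simp: fps_sum_nth intro!: sum.cong)
    also have "\<dots> = int (card {S \<in> Pow B. \<Sum>S = n})"
      using assms by (simp add: sum.inter_filter[symmetric])
    also have "{S \<in> Pow B. \<Sum>S = n} = distinct_partitions_in B n"
      using assms by (auto simp: distinct_partitions_in_def intro: finite_subset)
    finally show "(\<Sum>S\<in>Pow B. fps_X ^ \<Sum>S) $ n = distinct_partition_gf B $ n"
      by (simp add: distinct_partition_gf_def)
  qed
  finally show ?thesis by simp
qed

lemma distinct_partition_gf_mult_euler_fun:
  "distinct_partition_gf {0<..} * euler_fun 1 = euler_fun 2"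
proof (rule trunc_eqI)
  fix N :: nat
  have "trunc_eq N (distinct_partition_gf {0<..}) (distinct_partition_gf ({0<..} \<inter> {1..N}))"
    using distinct_partitions_in_Icc[of "{0<..}"] by (simp add: trunc_eq_def distinct_partition_gf_def)
  then have "trunc_eq N (distinct_partition_gf {0<..}) (\<Prod>i=1..N. 1 + fps_X ^ i)"
    by (simp add: distinct_partition_gf_finite Int_absorb1 subset_eq)
  moreover have "trunc_eq N (euler_fun 1) ((\<Prod>i=1..N. 1 - fps_X ^ (1 * i)) :: int fps)"
    by (rule euler_fun_trunc) auto
  ultimately have "trunc_eq N (distinct_partition_gf {0<..} * euler_fun 1)
      ((\<Prod>i=1..N. 1 + fps_X ^ i) * (\<Prod>i=1..N. 1 - fps_X ^ (1 * i)))"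
    by (rule trunc_eq_mult)
  also have "(\<Prod>i=1..N. 1 + fps_X ^ i) * (\<Prod>i=1..N. 1 - fps_X ^ (1 * i)) =
      ((\<Prod>i=1..N. 1 - fps_X ^ (2 * i)) :: int fps)"
    unfolding prod.distrib[symmetric]
    by (intro prod.cong) (simp_all add: algebra_simps mult_2 flip: power_add)
  also have "trunc_eq N \<dots> (euler_fun 2)"
    by (rule trunc_eq_sym, rule euler_fun_trunc) auto
  finally show "trunc_eq N (distinct_partition_gf {0<..} * euler_fun 1) (euler_fun 2)" .
qed

lemma Rstar_eq_sum:
  "Rstar l n = (\<Sum>k\<le>n. card (partitions_in {i. \<not> l dvd i} k) * card (distinct_partitions_in {0<..} (n - k)))"
proof -
  let ?A = "{i. \<not> l dvd i}"
  let ?L = "{\<pi> \<in> overpartitions n. \<forall>k \<in># nonoverlined \<pi>. \<not> l dvd k}"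
  let ?T = "\<lambda>k. partitions_in ?A k \<times> distinct_partitions_in {0<..} (n - k)"
  have fin: "finite (?T k)" for k
  proof -
    have "distinct_partitions_in {0<..} (n - k) \<subseteq> Pow {..n}"
      using member_le_sum[where f = "\<lambda>x. x :: nat"]
      by (fastforce simp: distinct_partitions_in_def)
    then have "finite (distinct_partitions_in {0<..} (n - k))"
      by (rule finite_subset) simp
    then show ?thesis using finite_partitions_in[of ?A k] by simp
  qed
  have sum_mset_set: "sum_mset (mset_set S) = \<Sum>S" for S :: "nat set"
    by (simp add: sum_unfold_sum_mset)
  have "bij_betw (\<lambda>(M, S). (M - mset_set S, S)) ?L (\<Union>k\<in>{..n}. ?T k)"
  proof (rule bij_betw_byWitness[where f' = "\<lambda>(M, S). (M + mset_set S, S)"])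
    have sub: "mset_set S \<subseteq># M \<and> finite S" if "S \<subseteq> set_mset M" for S and M :: "nat multiset"
      using that finite_subset[OF that]
      by (auto simp: subseteq_mset_def count_mset_set')
    show "\<forall>\<pi>\<in>?L. (\<lambda>(M, S). (M + mset_set S, S)) ((\<lambda>(M, S). (M - mset_set S, S)) \<pi>) = \<pi>"
      using sub by (auto simp: overpartitions_def)
    show "\<forall>\<pi>\<in>(\<Union>k\<in>{..n}. ?T k). (\<lambda>(M, S). (M - mset_set S, S)) ((\<lambda>(M, S). (M + mset_set S, S)) \<pi>) = \<pi>"
      by auto
    show "(\<lambda>(M, S). (M - mset_set S, S)) ` ?L \<subseteq> (\<Union>k\<in>{..n}. ?T k)"
    proof clarify
      fix M S assume MS: "(M, S) \<in> overpartitions n" "\<forall>k \<in># nonoverlined (M, S). \<not> l dvd k"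
      then have S: "S \<subseteq> set_mset M" "0 \<notin># M" "sum_mset M = n" by (auto simp: overpartitions_def)
      with sub have "sum_mset (M - mset_set S) + \<Sum>S = n"
        by (metis subset_mset.diff_add sum_mset.union sum_mset_set)
      moreover have "S \<subseteq> {0<..}" using S by (auto intro!: gr0I)
      ultimately show "(M - mset_set S, S) \<in> (\<Union>k\<in>{..n}. ?T k)"
        using sub[OF S(1)] MS(2)
        by (auto simp: partitions_in_def distinct_partitions_in_def nonoverlined_def
            intro!: bexI[of _ "sum_mset (M - mset_set S)"])
    qed
    show "(\<lambda>(M, S). (M + mset_set S, S)) ` (\<Union>k\<in>{..n}. ?T k) \<subseteq> ?L"
      by (auto simp: partitions_in_def distinct_partitions_in_def nonoverlined_def
          overpartitions_def sum_mset_set)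
  qed
  then have "Rstar l n = card (\<Union>k\<in>{..n}. ?T k)"
    unfolding Rstar_def by (rule bij_betw_same_card)
  also have "\<dots> = (\<Sum>k\<le>n. card (?T k))"
    using fin by (intro card_UN_disjoint) (auto simp: partitions_in_def)
  finally show ?thesis by (simp add: card_cartesian_product)
qed

definition Rstar_gf :: "nat \<Rightarrow> int fps" where
  "Rstar_gf l = Abs_fps (\<lambda>n. int (Rstar l n))"

lemma Rstar_gf_mult_euler_fun:
  "Rstar_gf l * (euler_fun 1)\<^sup>2 = euler_fun 2 * euler_fun l"
proof -
  let ?A = "{i. \<not> l dvd i}"
  have "{i :: nat. 0 < i \<and> 1 dvd i} = ?A \<union> {i. 0 < i \<and> l dvd i}" by (auto intro!: gr0I)
  then have f1: "euler_fun 1 = euler_prod ?A * (euler_fun l :: int fps)"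
    unfolding euler_fun_def by (simp only:) (rule euler_prod_Un, auto)
  have "Rstar_gf l = partition_gf ?A * distinct_partition_gf {0<..}"
    by (simp add: fps_eq_iff Rstar_gf_def fps_mult_nth Rstar_eq_sum partition_gf_def
        distinct_partition_gf_def atMost_atLeast0)
  then have "Rstar_gf l * (euler_fun 1)\<^sup>2 = (partition_gf ?A * euler_prod ?A) *
      (distinct_partition_gf {0<..} * euler_fun 1) * euler_fun l"
    unfolding power2_eq_square by (subst (2) f1) (simp only: mult_ac)
  then show ?thesis
    by (simp add: partition_gf_mult_euler_prod distinct_partition_gf_mult_euler_fun[unfolded One_nat_def])
qed

section \<open>Dissection modulo 3\<close>

lemma theta_2_1_mult_euler_fun: "theta 2 1 * euler_fun 2 = (euler_fun 1 :: int fps)\<^sup>2"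
proof -
  have "{0<..<2} = {1 :: nat}" by auto
  then have "(euler_fun 1 :: int fps) = euler_prod {i. i mod 2 = 1} * euler_fun 2"
    using euler_fun_residues[of 1 2, where ?'a = int] by simp
  moreover have "theta 2 1 = euler_prod {i. i mod 2 = 1} * euler_prod {i. i mod 2 = 1} * (euler_fun 2 :: int fps)"
    using jacobi_triple_product[of 1 2, where ?'a = int] by simp
  ultimately show ?thesis by (simp add: power2_eq_square mult_ac)
qed

lemma theta_2_1_nth:
  "(theta 2 1 :: int fps) $ n = (if n = 0 then 1 else if is_square n then 2 * (-1) ^ n else 0)"
proof -
  have "theta_exp 2 1 j = n \<longleftrightarrow> j * j = int n" for j
    using int_theta_exp_double[of 1 2 j] by (auto simp: algebra_simps simp flip: of_nat_eq_iff)
  then have th: "(theta 2 1 :: int fps) $ n = (\<Sum>j\<in>{j. j * j = int n}. (-1) ^ nat \<bar>j\<bar>)"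
    by (simp add: theta_def)
  show ?thesis
  proof (cases "is_square n")
    case True
    then obtain k where k: "n = k\<^sup>2" by (auto elim: is_nth_powerE)
    have "{j. j * j = int n} = {int k, - int k}"
      by (auto simp: k power2_eq_square square_eq_iff)
    then have "(theta 2 1 :: int fps) $ n = (\<Sum>j\<in>{int k, - int k}. (-1) ^ nat \<bar>j\<bar>)"
      unfolding th by (rule arg_cong)
    moreover have "(-1) ^ k = ((-1) ^ n :: int)"
      by (simp add: k minus_one_power_iff)
    ultimately show ?thesis using True k by (cases "k = 0") simp_all
  next
    case False
    have "j * j \<noteq> int n" for j
    proof
      assume "j * j = int n"
      then have "int (nat \<bar>j\<bar> ^ 2) = int n" by (simp add: power2_eq_square)
      then have "n = nat \<bar>j\<bar> ^ 2" by (simp only: of_nat_eq_iff)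
      with False show False by auto
    qed
    moreover from False have "n \<noteq> 0" by (intro notI) simp
    ultimately show ?thesis using False by (simp add: th[unfolded One_nat_def])
  qed
qed

lemma bit_theta_18_3_nth:
  "(fps_X * theta 18 3 :: bit fps) $ n = (if n mod 3 = 1 \<and> is_square n then 1 else 0)"
proof (cases "n = 0")
  case False
  let ?S = "{j. (3 * j - 1)\<^sup>2 = int n}"
  have "theta_exp 18 3 j = n - 1 \<longleftrightarrow> (3 * j - 1)\<^sup>2 = int n" for j
    using int_theta_exp_double[of 3 18 j] False
    by (auto simp: algebra_simps power2_eq_square of_nat_diff simp flip: of_nat_eq_iff)
  then have th: "(fps_X * theta 18 3 :: bit fps) $ n = of_nat (card ?S)"
    using False by (simp add: theta_def)
  show ?thesis
  proof (cases "n mod 3 = 1 \<and> is_square n")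
    case True
    then obtain k where k: "n = k\<^sup>2" by (auto elim: is_nth_powerE)
    have "\<not> 3 dvd k" using True by (auto simp: k power2_eq_square)
    then have "k mod 3 \<noteq> 0" by (simp add: dvd_eq_mod_eq_0)
    then have "k mod 3 = 1 \<or> k mod 3 = 2" by presburger
    then obtain s where s: "s\<^sup>2 = (int k)\<^sup>2" "s mod 3 = 2"
    proof
      assume "k mod 3 = 1"
      then have "(- int k) mod 3 = 2" by presburger
      then show thesis using that[of "- int k"] by simp
    next
      assume "k mod 3 = 2"
      then have "int k mod 3 = 2" by presburger
      then show thesis using that[of "int k"] by simp
    qed
    then have "(3 * j - 1)\<^sup>2 = int n \<longleftrightarrow> 3 * j - 1 = s \<or> 3 * j - 1 = - s" for j
      by (simp add: k flip: power2_eq_iff)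
    moreover have "3 * j - 1 \<noteq> - s" for j using s(2) by presburger
    moreover have "3 * j - 1 = s \<longleftrightarrow> j = (s + 1) div 3" for j using s(2) by presburger
    ultimately have "?S = {(s + 1) div 3}" by auto
    with th True show ?thesis by simp
  next
    case False
    have "(3 * j - 1)\<^sup>2 \<noteq> int n" for j
    proof
      assume j: "(3 * j - 1)\<^sup>2 = int n"
      then have "int (nat \<bar>3 * j - 1\<bar> ^ 2) = int n" by simp
      then have "n = nat \<bar>3 * j - 1\<bar> ^ 2" by (simp only: of_nat_eq_iff)
      then have "is_square n" by auto
      have "(3 * j - 1)\<^sup>2 = 3 * (3 * j * j - 2 * j) + 1"
        by (simp add: power2_eq_square algebra_simps)
      then have "int n = 3 * (3 * j * j - 2 * j) + 1" unfolding j .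
      then have "int n mod 3 = 1" by presburger
      then have "n mod 3 = 1" by presburger
      with \<open>is_square n\<close> show False using False by blast
    qed
    then show ?thesis unfolding th using False by simp
  qed
qed simp

definition residue3_part :: "nat \<Rightarrow> 'a::comm_ring_1 fps \<Rightarrow> 'a fps" where
  "residue3_part r f = Abs_fps (\<lambda>n. if n mod 3 = r then f $ n else 0)"

definition supported_mod3 :: "nat \<Rightarrow> 'a::comm_ring_1 fps \<Rightarrow> bool" where
  "supported_mod3 r f \<longleftrightarrow> (\<forall>n. n mod 3 \<noteq> r mod 3 \<longrightarrow> f $ n = 0)"

lemma residue3_part_nth: "residue3_part r f $ n = (if n mod 3 = r then f $ n else 0)"
  by (simp add: residue3_part_def)

lemma residue3_part_add: "residue3_part r (f + g) = residue3_part r f + residue3_part r g"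
  by (simp add: fps_eq_iff residue3_part_nth)

lemma residue3_part_numeral_mult:
  "residue3_part r (numeral c * f) = numeral c * residue3_part r f"
  by (simp add: fps_eq_iff residue3_part_nth numeral_fps_const)

lemma residue3_part_eq:
  "supported_mod3 r f \<Longrightarrow> s < 3 \<Longrightarrow> residue3_part s f = (if s = r mod 3 then f else 0)"
  by (auto simp: fps_eq_iff residue3_part_nth supported_mod3_def)

lemma supported_mod3_mult:
  assumes "supported_mod3 r f" "supported_mod3 s g"
  shows "supported_mod3 (r + s) (f * g)"
  unfolding supported_mod3_def
proof (intro allI impI)
  fix n assume n: "n mod 3 \<noteq> (r + s) mod 3"
  have "f $ i * g $ (n - i) = 0" if "i \<le> n" for i
  proof (cases "i mod 3 = r mod 3 \<and> (n - i) mod 3 = s mod 3")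
    case True
    then have "(i + (n - i)) mod 3 = (r + s) mod 3" by (metis mod_add_cong)
    with n that show ?thesis by simp
  qed (use assms in \<open>auto simp: supported_mod3_def\<close>)
  then show "(f * g) $ n = 0" by (auto simp: fps_mult_nth intro!: sum.neutral)
qed

lemma residue3_part_mult:
  assumes "supported_mod3 0 g"
  shows "residue3_part r (f * g) = residue3_part r f * g"
proof (rule fps_ext)
  fix n
  have "(if n mod 3 = r then f $ i * g $ (n - i) else 0) = residue3_part r f $ i * g $ (n - i)"
    if "i \<le> n" for i
  proof (cases "(n - i) mod 3 = 0")
    case True
    then have "n mod 3 = i mod 3" using that by presburger
    then show ?thesis by (simp add: residue3_part_nth)
  qed (use assms in \<open>simp add: supported_mod3_def\<close>)
  then show "residue3_part r (f * g) $ n = (residue3_part r f * g) $ n"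
    unfolding fps_mult_nth residue3_part_nth[of r "f * g"]
    by (auto intro!: sum.cong sum.neutral simp: fps_mult_nth)
qed

lemma supported_mod3_euler_fun:
  assumes "3 dvd k" "0 < k"
  shows "supported_mod3 0 (euler_fun k :: 'a::comm_ring_1 fps)"
  unfolding supported_mod3_def
proof (intro allI impI)
  fix n :: nat assume n: "n mod 3 \<noteq> 0 mod 3"
  have "supported_mod3 0 ((\<Prod>i=1..m. 1 - fps_X ^ (k * i)) :: 'a fps)" for m
  proof (induction m)
    case (Suc m)
    have "supported_mod3 0 (1 - fps_X ^ (k * Suc m) :: 'a fps)"
      using assms by (auto simp: supported_mod3_def)
    from supported_mod3_mult[OF Suc this] show ?case by simp
  qed (auto simp: supported_mod3_def)
  then have "((\<Prod>i=1..n. 1 - fps_X ^ (k * i)) :: 'a fps) $ n = 0"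
    using n by (simp add: supported_mod3_def)
  then show "(euler_fun k :: 'a fps) $ n = 0"
    using trunc_eqD[OF euler_fun_trunc[OF assms(2) order_refl, where ?'a = 'a]] by simp
qed

lemma square_mod_3: "(k :: nat)\<^sup>2 mod 3 \<noteq> 2"
proof -
  have "k mod 3 \<in> {0, 1, 2}" by auto
  then show ?thesis by (auto simp: power_mod[of k 3 2, symmetric])
qed

lemma Rstar_6_mod_8:
  assumes "\<not> [Rstar 6 (3 * m + 2) = 0] (mod 8)"
  obtains j :: int where "int m = 3 * (2 * j * (2 * j - 1))"
proof -
  define U V where
    "U = Abs_fps (\<lambda>n. if n mod 3 = 0 then (theta 2 1 :: int fps) $ n else 0)" and
    "V = Abs_fps (\<lambda>n. if n mod 3 = 1 \<and> is_square n then - ((-1) ^ n) else 0 :: int)"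
  let ?G = "Rstar_gf 6" and ?f = "euler_fun 6 :: int fps"
  have sq: "n mod 3 = 0 \<or> n mod 3 = 1" if "is_square n" for n :: nat
  proof -
    have "n mod 3 \<noteq> 2" using that by (auto elim!: is_nth_powerE simp: square_mod_3)
    then show ?thesis by presburger
  qed
  have theta: "theta 2 1 = U - 2 * V"
    by (auto dest: sq simp: fps_eq_iff U_def V_def numeral_fps_const theta_2_1_nth[unfolded One_nat_def])
  have U0: "U $ 0 = 1" by (simp add: U_def theta_2_1_nth[unfolded One_nat_def])
  have "fps_mod2 U = 1" by (auto simp: fps_eq_iff U_def theta_2_1_nth[unfolded One_nat_def])
  have "fps_mod2 V = fps_X * theta 18 3"
    by (rule fps_ext, unfold bit_theta_18_3_nth) (auto simp: V_def)
  have sU: "supported_mod3 0 U" and sV: "supported_mod3 1 V"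
    by (auto simp: supported_mod3_def U_def V_def)
  have sf: "supported_mod3 0 ?f" by (rule supported_mod3_euler_fun) auto

  have "euler_fun 2 \<noteq> (0 :: int fps)" by (metis euler_fun_nth_0 fps_zero_nth zero_neq_one)
  moreover have "?G * theta 2 1 * euler_fun 2 = ?f * euler_fun 2"
    by (simp only: mult.assoc theta_2_1_mult_euler_fun Rstar_gf_mult_euler_fun)
      (simp only: mult.commute)
  ultimately have "?G * theta 2 1 = ?f" by (metis mult_right_cancel)
  then have G: "?G * (U - 2 * V) = ?f" by (simp only: theta)

  have "?G * U ^ 3 = ?G * (U - 2 * V) * (U\<^sup>2 + 2 * (U * V) + 4 * V\<^sup>2) + 8 * (?G * V ^ 3)"
    by (simp add: algebra_simps power2_eq_square power3_eq_cube)
  then have "?G * U ^ 3 = ?f * (U * U) + 2 * (?f * (U * V)) + 4 * (?f * (V * V)) + 8 * (?G * V ^ 3)"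
    unfolding G by (simp add: algebra_simps power2_eq_square)
  then have "residue3_part 2 (?G * U ^ 3) = 4 * (?f * V\<^sup>2) + 8 * residue3_part 2 (?G * V ^ 3)"
    using residue3_part_eq[OF supported_mod3_mult[OF sf supported_mod3_mult[OF sU sU]], of 2]
      residue3_part_eq[OF supported_mod3_mult[OF sf supported_mod3_mult[OF sU sV]], of 2]
      residue3_part_eq[OF supported_mod3_mult[OF sf supported_mod3_mult[OF sV sV]], of 2]
    by (simp add: residue3_part_add residue3_part_numeral_mult power2_eq_square)
  moreover have "supported_mod3 0 (U ^ 3)"
    using supported_mod3_mult[OF supported_mod3_mult[OF sU sU] sU] by (simp add: power3_eq_cube)
  then have "residue3_part 2 (?G * U ^ 3) = residue3_part 2 ?G * U ^ 3"
    by (rule residue3_part_mult)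
  ultimately have G2: "residue3_part 2 ?G * U ^ 3 =
      4 * (?f * V\<^sup>2 + 2 * residue3_part 2 (?G * V ^ 3))"
    by (simp add: distrib_left)
  have "(U ^ 3) $ 0 = 1" using U0 by (simp add: fps_nth_power_0)
  then obtain W where W: "U ^ 3 * W = 1" using fps_unit_of_nth_0 by blast
  define H where "H = (?f * V\<^sup>2 + 2 * residue3_part 2 (?G * V ^ 3)) * W"
  have "residue3_part 2 ?G = residue3_part 2 ?G * U ^ 3 * W" by (simp add: mult.assoc W)
  then have "residue3_part 2 ?G = 4 * H" unfolding G2 by (simp add: H_def mult.assoc)
  then have "residue3_part 2 ?G $ (3 * m + 2) = (4 * H) $ (3 * m + 2)" by simp
  moreover have "(3 * m + 2) mod 3 = 2" by presburger
  ultimately have RH: "int (Rstar 6 (3 * m + 2)) = 4 * H $ (3 * m + 2)"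
    by (simp add: residue3_part_nth Rstar_gf_def numeral_fps_const del: add_2_eq_Suc')

  have "fps_mod2 W = fps_mod2 (U ^ 3 * W)"
    by (simp only: fps_mod2_mult fps_mod2_power \<open>fps_mod2 U = 1\<close> power_one mult_1)
  then have "fps_mod2 W = 1" by (simp add: W fps_mod2_1)
  moreover have "fps_mod2 (f + 2 * g) = fps_mod2 f" for f g
    by (simp add: fps_eq_iff numeral_fps_const)
  ultimately have "fps_mod2 H = euler_fun 6 * (fps_X * theta 18 3)\<^sup>2"
    using \<open>fps_mod2 V = _\<close>
    by (simp add: H_def fps_mod2_mult fps_mod2_power fps_mod2_euler_prod euler_fun_def)
  also have "\<dots> = fps_X ^ 2 * (theta (6 * 3) 3 * euler_fun 3)\<^sup>2"
    using bit_euler_fun_double[of 3] by (simp add: power_mult_distrib)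
  also have "(theta (6 * 3) 3 * euler_fun 3)\<^sup>2 = (euler_fun 9 ^ 3 :: bit fps)\<^sup>2"
    by (subst bit_theta_mult_euler_fun) simp_all
  also have "\<dots> = euler_fun 18 ^ 3"
    using bit_euler_fun_double[of 9] by (simp flip: power_mult)
  also have "\<dots> = theta 72 18"
    using bit_theta_eq_euler_fun_cube[of 18] by simp
  finally have "fps_mod2 H $ (3 * m + 2) = (theta 72 18 :: bit fps) $ (3 * m)"
    by (simp only: fps_X_power_mult_nth) simp
  moreover have "odd (H $ (3 * m + 2))"
  proof
    assume "even (H $ (3 * m + 2))"
    then have "int 8 dvd int (Rstar 6 (3 * m + 2))" unfolding RH by auto
    with assms show False unfolding int_dvd_int_iff by (simp add: cong_0_iff)
  qed
  then have "fps_mod2 H $ (3 * m + 2) = 1" by (auto elim!: oddE)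
  ultimately have "(\<Sum>j\<in>{j. theta_exp 72 18 j = 3 * m}. (-1) ^ nat \<bar>j\<bar>) = (1 :: bit)"
    by (simp add: theta_def)
  then have "{j. theta_exp 72 18 j = 3 * m} \<noteq> {}" by (metis sum.empty zero_neq_one)
  then obtain j where "theta_exp 72 18 j = 3 * m" by auto
  then have "int m = 3 * (2 * j * (2 * j - 1))"
    using int_theta_exp_double[of 18 72 j] by (simp add: algebra_simps)
  then show thesis by (rule that)
qed

theorem theorem1p10:
  fixes p r n :: nat and t :: int
  assumes "prime p" and "p \<ge> 5"
    and "1 \<le> r" and "r \<le> p - 1"
    and "[3 * t = 1] (mod int p)"
    and "\<not> QuadRes (int p) (4 * t * int r + 1)"
  shows "[Rstar 6 (3 * (p * n + r) + 2) = 0] (mod 8)"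
proof (rule ccontr)
  assume "\<not> ?thesis"
  then obtain j where j: "int (p * n + r) = 3 * (2 * j * (2 * j - 1))"
    using Rstar_6_mod_8[of "p * n + r"] by blast
  have "[4 * t * int r + 1 = 4 * t * int (p * n + r) + 1] (mod int p)"
    by (intro cong_add cong_mult cong_refl) (simp add: cong_def)
  also have "4 * t * int (p * n + r) + 1 = 3 * t * (4 * (2 * j * (2 * j - 1))) + 1"
    unfolding j by (simp only: mult_ac)
  also have "[3 * t * (4 * (2 * j * (2 * j - 1))) + 1 = 1 * (4 * (2 * j * (2 * j - 1))) + 1] (mod int p)"
    by (intro cong_add cong_mult cong_refl assms)
  also have "1 * (4 * (2 * j * (2 * j - 1))) + 1 = (4 * j - 1)\<^sup>2"
    by (simp add: power2_eq_square algebra_simps)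
  finally have "QuadRes (int p) (4 * t * int r + 1)"
    unfolding QuadRes_def by (blast intro: cong_sym)
  with assms show False by blast
qed

end
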